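(* We have the $q$-exponential generating function $$\sum_{n\geq 0}A_{n+1}(q,1)\frac{x^n}{n_q^!}=e_q\left[\frac{e_q(qx)-1}{q}\right]=\prod_{j\geq 0}\left(1-(1-q)q^jx\,e_q(q^{j+1}x)\right)^{-1},$$ where $e_q(x)=\sum_{n\geq 0}\frac{x^n}{n_q^!}$.
   Context: Permutations $\pi=\pi_1\cdots\pi_n$ of $[n]=\{1,\ldots,n\}$ are written in one-line notation. $\mathrm{inv}(\pi)$ is the number of pairs $(i,j)$ with $1\le i<j\le n$ and $\pi_i>\pi_j$. A run of $\pi$ is a maximal increasing sequence of consecutive entries; $\mathrm{run}(\pi)$ is the number of runs. A permutation is run-sorted if $\pi_1=1$ and the first entries of its runs, read from left to right, form an increasing sequence. $\mathcal{R}_n$ denotes the set of run-sorted permutations of $[n]$, and $A_n(q,u)=\sum_{\pi\in\mathcal{R}_n}q^{\mathrm{inv}(\pi)}u^{\mathrm{run}(\pi)}$; thus $A_n(q,1)=\sum_{\pi\in\mathcal{R}_n}q^{\mathrm{inv}(\pi)}$. For $n\ge 1$, $n_q=1+q+\cdots+q^{n-1}$, $n_q^!=\prod_{i=1}^n i_q$, $0_q^!=1$, and $\binom{n}{k}_q=\frac{n_q^!}{k_q^!(n-k)_q^!}$ for $0\le k\le n$. The square brackets denote Gessel's $q$-composition of $q$-exponential generating functions with $e_q$, which is characterized as follows: for $f(x)=\sum_{n\geq 1}f_n\frac{x^n}{n_q^!}$, the series $e_q[f(x)]$ is the series $g(x)=\sum_{n\geq 0}g_n\frac{x^n}{n_q^!}$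 determined by $g_0=1$ and $g_{n+1}=\sum_{k=0}^n\binom{n}{k}_q f_{k+1}g_{n-k}$ for $n\geq 0$. Identities are between formal power series in $x$ whose coefficients are formal power series in $q$ (the infinite product converges in this formal sense). *)

theory Defs
  imports
    "HOL-Computational_Algebra.Formal_Power_Series"
    "HOL-Combinatorics.Multiset_Permutations"
begin

text \<open>
  Permutations of \<open>{1..n}\<close> in one-line notation are the lists in
  \<open>permutations_of_set {1..n}\<close>; the entry $\pi_i$ is \<open>\<pi> ! (i - 1)\<close>.
\<close>

definition inv_num :: "nat list \<Rightarrow> nat" where
  "inv_num \<pi> = card {(i, j). i < j \<and> j < length \<pi> \<and> \<pi> ! i > \<pi> ! j}"

definition increasing_block :: "nat list \<Rightarrow> nat \<Rightarrow> nat \<Rightarrow> bool" where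
  "increasing_block \<pi> i j \<longleftrightarrow> i \<le> j \<and> j < length \<pi> \<and> strict_mono_on {i..j} ((!) \<pi>)"

text \<open>A run is represented by the pair of its first and last position.\<close>

definition runs :: "nat list \<Rightarrow> (nat \<times> nat) set" where
  "runs \<pi> = {(i, j). increasing_block \<pi> i j \<and>
     (\<forall>i' j'. increasing_block \<pi> i' j' \<and> i' \<le> i \<and> j \<le> j' \<longrightarrow> i' = i \<and> j' = j)}"

definition run_num :: "nat list \<Rightarrow> nat" where
  "run_num \<pi> = card (runs \<pi>)"

definition run_sorted :: "nat list \<Rightarrow> bool" where
  "run_sorted \<pi> \<longleftrightarrow> \<pi> \<noteq> [] \<and> \<pi> ! 0 = 1 \<and>
     (\<forall>(i, j) \<in> runs \<pi>. \<forall>(i', j') \<in> runs \<pi>. i < i' \<longrightarrow> \<pi> ! i < \<pi> ! i')"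

definition run_sorted_perms :: "nat \<Rightarrow> nat list set" where
  "run_sorted_perms n = {\<pi> \<in> permutations_of_set {1..n}. run_sorted \<pi>}"

definition A_gf :: "nat \<Rightarrow> 'a::comm_semiring_1 \<Rightarrow> 'a \<Rightarrow> 'a" where
  "A_gf n q u = (\<Sum>\<pi>\<in>run_sorted_perms n. q ^ inv_num \<pi> * u ^ run_num \<pi>)"

text \<open>
  Series in $x$ over series in $q$ have type \<open>rat fps fps\<close>: the inner variable is $q$,
  the outer one is $x$. Rational coefficients make division by series in $q$ with nonzero
  constant term available on \<open>rat fps\<close>.
\<close>

abbreviation Q :: "rat fps" where "Q \<equiv> fps_X"

abbreviation X :: "rat fps fps" where "X \<equiv> fps_X"

definition q_int :: "nat \<Rightarrow> rat fps" where
  "q_int n = (\<Sum>i<n. Q ^ i)"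

definition q_fact :: "nat \<Rightarrow> rat fps" where
  "q_fact n = (\<Prod>i=1..n. q_int i)"

definition q_binomial :: "nat \<Rightarrow> nat \<Rightarrow> rat fps" where
  "q_binomial n k = q_fact n / (q_fact k * q_fact (n - k))"

definition q_egf :: "(nat \<Rightarrow> rat fps) \<Rightarrow> rat fps fps" where
  "q_egf a = Abs_fps (\<lambda>n. a n / q_fact n)"

definition q_egf_coeff :: "rat fps fps \<Rightarrow> nat \<Rightarrow> rat fps" where
  "q_egf_coeff f n = fps_nth f n * q_fact n"

definition e_q :: "rat fps fps" where
  "e_q = q_egf (\<lambda>_. 1)"

text \<open>
  Gessel's $q$-composition $e_q[f]$, meaningful for \<open>fps_nth f 0 = 0\<close>.
\<close>

fun e_q_comp_coeff :: "(nat \<Rightarrow> rat fps) \<Rightarrow> nat \<Rightarrow> rat fps" where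
  "e_q_comp_coeff f 0 = 1"
| "e_q_comp_coeff f (Suc n) =
     (\<Sum>k\<le>n. q_binomial n k * f (Suc k) * e_q_comp_coeff f (n - k))"

definition e_q_comp :: "rat fps fps \<Rightarrow> rat fps fps" where
  "e_q_comp f = q_egf (e_q_comp_coeff (q_egf_coeff f))"

text \<open>
  Division by a series in $q$ has to be done coefficientwise: division on \<open>rat fps fps\<close>
  by \<open>fps_const Q\<close> is not exact, since it goes through \<open>inverse Q = 0\<close>, whereas
  \<open>Q ^ n / Q = Q ^ (n - 1)\<close> holds on \<open>rat fps\<close> for \<open>n \<ge> 1\<close>.
\<close>

definition divide_coeffs :: "rat fps fps \<Rightarrow> rat fps \<Rightarrow> rat fps fps" where
  "divide_coeffs f c = Abs_fps (\<lambda>n. fps_nth f n / c)"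

definition scale_arg :: "rat fps fps \<Rightarrow> rat fps \<Rightarrow> rat fps fps" where
  "scale_arg f c = f oo (fps_const c * X)"

text \<open>
  The metric on \<open>rat fps fps\<close> is the $x$-adic one and treats the coefficients as discrete.
  The product below converges only with respect to the $q$-adic topology on the coefficients,
  so formal convergence is convergence of every $x$-coefficient in \<open>rat fps\<close>.
\<close>

definition has_formal_prod :: "(nat \<Rightarrow> rat fps fps) \<Rightarrow> rat fps fps \<Rightarrow> bool" where
  "has_formal_prod F P \<longleftrightarrow>
     (\<forall>n. (\<lambda>N. fps_nth (\<Prod>j<N. F j) n) \<longlonglongrightarrow> fps_nth P n)"

end

theory Submission
  imports Defs
begin

text \<open>
  The first equality is a recurrence for run-sorted permutations. Call the first entry of a run
  its head. In a run-sorted permutation of $[n+2]$ the entry $2$ either follows $1$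
  immediately or is preceded by a larger entry; in the latter case it is the head of a run, and,
  because the heads increase, of the second run. Either way the permutation reads
  $1\,a_1<\cdots<a_k\;2\;\ldots$, where the part from $2$ on is an arbitrary run-sorted
  arrangement of the remaining entries and $A=\{a_1,\ldots,a_k\}$ is an arbitrary subset
  of $\{3,\ldots,n+2\}$ (\<open>run_sorted_on_decomposition\<close>). The block $A$ has $k$ inversions
  with the entry $2$ and otherwise only those with the later entries above $2$, whose generating
  function over all $k$-subsets is the Gaussian binomial (\<open>subset_sum_eq_q_binomial\<close>).
  Hence $A_{n+2}(q,1)=\sum_k\binom{n}{k}_q q^k A_{n-k+1}(q,1)$, which is the recurrence that
  defines the $q$-composition of $e_q$ with $(e_q(qx)-1)/q=\sum_{k\ge1}q^{k-1}x^k/k_q^!$. In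
  order to iterate without relabelling, arrangements of arbitrary finite sets of numbers
  are counted; the result depends on the size of the set only (\<open>sum_run_sorted_on\<close>).

  For the product, let $G$ be the $q$-composition. Its recurrence says that the
  $q$-derivative $(G(x)-G(qx))/((1-q)x)$ equals $e_q(qx)\,G(x)$, that is,
  $G(x)\,(1-(1-q)x\,e_q(qx))=G(qx)$. Replacing $x$ by $q^jx$ and telescoping over $j<N$ gives
  $G(x)=P_N(x)\,G(q^Nx)$ for the $N$-th partial product $P_N$. Since $G(q^Nx)$ is congruent
  to $G(0)=1$ modulo $q^N$, every coefficient of $P_N$ converges $q$-adically to that of $G$.
\<close>

section \<open>Run-sorted permutations by their run heads\<close>

text \<open>
  Reading a sequence from left to right: \<open>m\<close> is the head of the run being read and \<open>x\<close> its
  latest entry. A descent closes this run, and the entry after it must exceed \<open>m\<close>.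
\<close>
fun heads_increase :: "nat \<Rightarrow> nat \<Rightarrow> nat list \<Rightarrow> bool" where
  "heads_increase m x [] = True"
| "heads_increase m x (y # ys) =
     (if x < y then heads_increase m y ys else m < y \<and> heads_increase y y ys)"

definition descents :: "nat list \<Rightarrow> nat set" where
  "descents xs = {i. Suc i < length xs \<and> xs ! Suc i \<le> xs ! i}"

lemma descents_Nil_singleton [simp]: "descents [] = {}" "descents [x] = {}"
  by (auto simp: descents_def)

lemma descents_Cons_Cons:
  "descents (x # y # ys) = (if x < y then {} else {0}) \<union> Suc ` descents (y # ys)"
proof (rule set_eqI)
  fix i show "i \<in> descents (x # y # ys) \<longleftrightarrow> i \<in> (if x < y then {} else {0}) \<union> Suc ` descents (y # ys)"
    by (cases i) (auto simp: descents_def)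
qed

text \<open>
  The recursion compares each head only with the one before it; transitivity turns this into
  the comparison of all pairs of heads. The outer \<open>m\<close> stands for a head that need not occur
  in the list, which makes the induction go through.
\<close>
lemma heads_increase_iff:
  "heads_increase m x ys \<longleftrightarrow>
     (\<forall>i\<in>descents (x # ys). m < (x # ys) ! Suc i) \<and>
     (\<forall>i\<in>descents (x # ys). \<forall>j\<in>descents (x # ys). i < j \<longrightarrow> (x # ys) ! Suc i < (x # ys) ! Suc j)"
proof (induction ys arbitrary: m x)
  case (Cons y ys)
  show ?case
  proof (cases "x < y")
    case True
    then show ?thesis
      using Cons.IH[of m y] by (simp add: descents_Cons_Cons)
  next
    case False
    have "heads_increase m x (y # ys) \<longleftrightarrow> m < y \<and> heads_increase y y ys"
      using False by simp
    then show ?thesis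
      using Cons.IH[of y y] False by (auto simp: descents_Cons_Cons dest: less_trans)
  qed
qed simp

lemma increasing_block_extend_left:
  assumes "increasing_block xs (Suc i) j" "xs ! i < xs ! Suc i"
  shows "increasing_block xs i j"
  unfolding increasing_block_def
proof (intro conjI strict_mono_onI)
  show "i \<le> j" "j < length xs" using assms(1) by (auto simp: increasing_block_def)
next
  fix r s assume rs: "r \<in> {i..j}" "s \<in> {i..j}" "r < s"
  have sm: "strict_mono_on {Suc i..j} ((!) xs)"
    using assms(1) by (auto simp: increasing_block_def)
  show "xs ! r < xs ! s"
  proof (cases "r = i")
    case True
    then have "xs ! Suc i \<le> xs ! s"
      using rs strict_mono_onD[OF sm, of "Suc i" s] by (cases "s = Suc i") auto
    then show ?thesis using True assms(2) by simp
  next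
    case False
    then show ?thesis using rs strict_mono_onD[OF sm, of r s] by auto
  qed
qed

text \<open>
  Runs are maximal increasing blocks, so a position begins a run exactly when no block can be
  extended across its left edge: it is the first position or follows a descent. For the
  converse, the run is the longest block that begins there.
\<close>
lemma run_heads:
  assumes "xs \<noteq> []"
  shows "fst ` runs xs = insert 0 (Suc ` descents xs)"
proof (intro equalityI subsetI)
  fix i assume "i \<in> fst ` runs xs"
  then obtain j where ij: "(i, j) \<in> runs xs" by auto
  show "i \<in> insert 0 (Suc ` descents xs)"
  proof (cases i)
    case (Suc k)
    have blk: "increasing_block xs (Suc k) j" using ij Suc by (auto simp: runs_def)
    \<comment> \<open>Otherwise the block could be prolonged by its left neighbour, against maximality.\<close>
    have "\<not> increasing_block xs k j"
      using ij Suc by (fastforce simp: runs_def)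
    then have "xs ! Suc k \<le> xs ! k"
      using increasing_block_extend_left[OF blk] by fastforce
    then show ?thesis using Suc blk by (auto simp: descents_def increasing_block_def)
  qed simp
next
  fix i assume i: "i \<in> insert 0 (Suc ` descents xs)"
  then have len: "i < length xs" using assms by (auto simp: descents_def)
  define J where "J = {j. increasing_block xs i j}"
  have "finite J" by (rule finite_subset[of _ "{..<length xs}"]) (auto simp: J_def increasing_block_def)
  moreover have "i \<in> J" using len by (auto simp: J_def increasing_block_def strict_mono_on_def)
  ultimately have max: "Max J \<in> J" "\<And>j. j \<in> J \<Longrightarrow> j \<le> Max J"
    by (auto intro: Max_in)
  have "(i, Max J) \<in> runs xs"
    unfolding runs_def
  proof (clarsimp, intro conjI allI impI)
    show "increasing_block xs i (Max J)" using max(1) by (simp add: J_def)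
  next
    fix i' j' assume *: "increasing_block xs i' j' \<and> i' \<le> i \<and> Max J \<le> j'"
    have iM: "i \<le> Max J" using max(2) \<open>i \<in> J\<close> by blast
    show "i' = i"
    proof (rule ccontr)
      assume "i' \<noteq> i"
      then obtain k where k: "i = Suc k" "k \<in> descents xs" "i' \<le> k"
        using i * by auto
      have "xs ! k < xs ! Suc k"
        using * k iM by (intro strict_mono_onD[of "{i'..j'}" "(!) xs"]) (auto simp: increasing_block_def)
      then show False using k(2) by (simp add: descents_def)
    qed
    then have "j' \<in> J" using * by (simp add: J_def)
    then show "j' = Max J" using max(2)[of j'] * by simp
  qed
  then show "i \<in> fst ` runs xs" by force
qed

lemma run_sorted_iff_heads_increase:
  "run_sorted (x # ys) \<longleftrightarrow> x = 1 \<and> heads_increase 1 1 ys"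
proof -
  have "run_sorted (x # ys) \<longleftrightarrow> x = 1 \<and>
    (\<forall>i\<in>fst ` runs (x # ys). \<forall>j\<in>fst ` runs (x # ys). i < j \<longrightarrow> (x # ys) ! i < (x # ys) ! j)"
    by (simp add: run_sorted_def split_beta)
  also have "\<dots> \<longleftrightarrow> x = 1 \<and> heads_increase x x ys"
    by (simp add: run_heads heads_increase_iff)
  finally show ?thesis by auto
qed

section \<open>Splitting a run-sorted arrangement at its second smallest entry\<close>

text \<open>
  The defining condition of run-sortedness with \<open>Min S\<close> in the role of $1$, so that the tail of
  a run-sorted permutation is an object of the same kind.
\<close>
definition run_sorted_on :: "nat set \<Rightarrow> nat list set" where
  "run_sorted_on S =
     {xs \<in> permutations_of_set S. hd xs = Min S \<and> heads_increase (Min S) (Min S) (tl xs)}"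

lemma run_sorted_perms_eq_run_sorted_on:
  "run_sorted_perms (Suc n) = run_sorted_on {1..Suc n}"
proof -
  have "Min {1..Suc n} = 1" by (rule Min_eqI) auto
  moreover have "run_sorted xs \<longleftrightarrow> hd xs = 1 \<and> heads_increase 1 1 (tl xs)"
    if "xs \<in> permutations_of_set {1..Suc n}" for xs
    using that run_sorted_iff_heads_increase[of "hd xs" "tl xs"]
    by (cases xs) (auto simp: permutations_of_set_def)
  ultimately show ?thesis
    by (auto simp: run_sorted_perms_def run_sorted_on_def)
qed

lemma heads_increase_imp_greater:
  "heads_increase m x ys \<Longrightarrow> m \<le> x \<Longrightarrow> z \<in> set ys \<Longrightarrow> m < z"
proof (induction ys arbitrary: m x)
  case (Cons y ys)
  show ?case
  proof (cases "x < y")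
    case True
    then show ?thesis using Cons.IH[of m y] Cons.prems by auto
  next
    case False
    then show ?thesis using Cons.IH[of y y] Cons.prems by auto
  qed
qed simp

text \<open>
  The current head matters only through comparisons with later entries, so any two lower bounds
  of these entries are interchangeable.
\<close>
lemma heads_increase_change_head:
  assumes "\<forall>y\<in>set ys. m < y \<and> m' < y"
  shows "heads_increase m x ys = heads_increase m' x ys"
  using assms by (induction ys arbitrary: x) auto

text \<open>
  A descent inside the block \<open>as\<close> would create a head above \<open>p\<close>; then \<open>p\<close>, smaller than its
  predecessor, would begin a later run with a smaller head. So \<open>as\<close> continues the first run, and
  from \<open>p\<close> on the first head \<open>m\<close> is irrelevant. The alternative \<open>x = m\<close> covers an empty block, in
  which case \<open>p\<close> continues the first run instead of beginning the second.
\<close>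
lemma heads_increase_split:
  assumes "m < p" "\<forall>y\<in>set as \<union> set bs. p < y" "x = m \<or> p < x"
  shows "heads_increase m x (as @ p # bs) \<longleftrightarrow> sorted_wrt (<) (x # as) \<and> heads_increase p p bs"
  using assms(2,3)
proof (induction as arbitrary: x)
  case Nil
  have "heads_increase m p bs = heads_increase p p bs"
    using Nil assms(1) by (intro heads_increase_change_head) auto
  then show ?case using Nil assms(1) by auto
next
  case (Cons y as)
  show ?case
  proof (cases "x < y")
    case True
    have "heads_increase m y (as @ p # bs) \<longleftrightarrow> sorted_wrt (<) (y # as) \<and> heads_increase p p bs"
      using Cons.prems by (intro Cons.IH) auto
    then show ?thesis using True by (auto dest: less_trans)
  next
    case False
    have "\<not> heads_increase y y (as @ p # bs)"
      using heads_increase_imp_greater[of y y "as @ p # bs" p] Cons.prems by auto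
    then show ?thesis using False by auto
  qed
qed

text \<open>
  The inverse of cutting an arrangement just before its second smallest entry.
\<close>
definition glue :: "nat \<Rightarrow> nat set \<times> nat list \<Rightarrow> nat list" where
  "glue m = (\<lambda>(A, r). m # sorted_list_of_set A @ r)"

lemma run_sorted_on_ConsE:
  assumes "r \<in> run_sorted_on S" "finite S" "S \<noteq> {}"
  obtains r' where "r = Min S # r'" "set r' = S - {Min S}" "distinct r'"
    "heads_increase (Min S) (Min S) r'"
  using assms by (cases r) (auto simp: run_sorted_on_def permutations_of_set_def)

text \<open>
  By \<open>heads_increase_split\<close>, what lies between the smallest entry \<open>m\<close> and the second smallest
  entry \<open>p\<close> is increasing and hence determined by its set, which is unrestricted; the part from
  \<open>p\<close> on is run-sorted by itself.
\<close>
lemma run_sorted_on_decomposition: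
  assumes fin: "finite S" and m: "m = Min S" and U: "U = S - {m}" and p: "p = Min U" and ne: "U \<noteq> {}"
  shows "bij_betw (glue m) (SIGMA A:Pow (U - {p}). run_sorted_on (U - A)) (run_sorted_on S)"
proof -
  have finU: "finite U" using fin U by simp
  have pU: "p \<in> U" using Min_in[OF finU ne] p by simp
  have p_less: "p < y" if "y \<in> U" "y \<noteq> p" for y
    using Min_le[OF finU that(1)] that(2) p by simp
  have mS: "m \<in> S" using Min_in[OF fin] m ne U by auto
  have m_le: "m \<le> y" if "y \<in> S" for y
    using Min_le[OF fin that] m by simp
  have m_less: "m < p" using m_le[of p] pU U by auto
  have Min_rest: "Min (U - A) = p" if "A \<subseteq> U - {p}" for A
  proof (rule Min_eqI)
    fix y assume "y \<in> U - A"
    then show "p \<le> y" using p_less[of y] by (cases "y = p") auto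
  qed (use that finU pU in auto)
  have rest: "\<exists>r'. r = p # r' \<and> set r' = U - A - {p} \<and> distinct r' \<and> heads_increase p p r'"
    if "A \<subseteq> U - {p}" "r \<in> run_sorted_on (U - A)" for A r
    using that(2) finU pU that(1) Min_rest[OF that(1)]
    by (elim run_sorted_on_ConsE) auto
  have inj: "inj_on (glue m) (SIGMA A:Pow (U - {p}). run_sorted_on (U - A))"
  proof (rule inj_onI, clarify)
    fix A r B s
    assume A: "A \<subseteq> U - {p}" "r \<in> run_sorted_on (U - A)"
      and B: "B \<subseteq> U - {p}" "s \<in> run_sorted_on (U - B)"
      and eq: "glue m (A, r) = glue m (B, s)"
    obtain r' s' where rs: "r = p # r'" "s = p # s'"
      "set r' = U - A - {p}" "set s' = U - B - {p}"
      using rest[OF A] rest[OF B] by auto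
    have finAB: "finite A" "finite B" using A(1) B(1) finU by (auto intro: finite_subset)
    have eq': "sorted_list_of_set A @ p # r' = sorted_list_of_set B @ p # s'"
      using eq rs by (simp add: glue_def)
    have "p \<notin> set (sorted_list_of_set A)" "p \<notin> set (sorted_list_of_set B)"
      using A(1) B(1) finAB by auto
    moreover have "p \<notin> set r'" "p \<notin> set s'" using rs by auto
    ultimately have "sorted_list_of_set A = sorted_list_of_set B \<and> r' = s'"
      using eq' by (metis append_Cons_eq_iff)
    then show "A = B \<and> r = s" using finAB rs by (metis set_sorted_list_of_set)
  qed
  have "glue m (A, r) \<in> run_sorted_on S" if A: "A \<subseteq> U - {p}" "r \<in> run_sorted_on (U - A)" for A r
  proof -
    obtain r' where r: "r = p # r'" "set r' = U - A - {p}" "distinct r'" "heads_increase p p r'"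
      using rest[OF A] by auto
    have finA: "finite A" using A(1) finU by (auto intro: finite_subset)
    have above: "\<forall>y\<in>set (sorted_list_of_set A) \<union> set r'. p < y"
      using A(1) r(2) finA p_less by auto
    have "\<forall>y\<in>A. m < y" using above finA m_less by (auto dest: less_trans)
    then have "sorted_wrt (<) (m # sorted_list_of_set A)" using finA by simp
    then have "heads_increase m m (sorted_list_of_set A @ p # r')"
      using heads_increase_split[OF m_less above] r(4) by simp
    moreover have "glue m (A, r) \<in> permutations_of_set S"
      using A r finA U mS pU by (auto simp: glue_def permutations_of_set_def)
    ultimately show ?thesis using r m by (auto simp: run_sorted_on_def glue_def)
  qed
  moreover have "xs \<in> glue m ` (SIGMA A:Pow (U - {p}). run_sorted_on (U - A))"
    if xs: "xs \<in> run_sorted_on S" for xs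
  proof -
    obtain zs where zs: "xs = m # zs" "set zs = U" "distinct zs" "heads_increase m m zs"
      using run_sorted_on_ConsE[OF xs fin] mS m U by blast
    obtain as r' where sp: "zs = as @ p # r'" using pU zs(2) by (metis split_list)
    have "sorted_wrt (<) (m # as) \<and> heads_increase p p r'"
      using zs sp m_less p_less by (subst heads_increase_split[symmetric]) auto
    then have as: "sorted_wrt (<) as" "heads_increase p p r'" by auto
    have A: "set as \<subseteq> U - {p}" using zs sp by auto
    have "sorted_list_of_set (set as) = as"
      using as(1) by (simp add: strict_sorted_iff sorted_list_of_set.idem_if_sorted_distinct)
    then have "xs = glue m (set as, p # r')" using zs sp by (simp add: glue_def)
    moreover have "p # r' \<in> run_sorted_on (U - set as)"
      using zs sp as Min_rest[OF A] by (auto simp: run_sorted_on_def permutations_of_set_def)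
    ultimately show ?thesis using A by blast
  qed
  ultimately show ?thesis using inj by (auto simp: bij_betw_def)
qed

section \<open>Counting inversions\<close>

lemma inv_num_Cons: "inv_num (x # xs) = length (filter (\<lambda>y. y < x) xs) + inv_num xs"
proof -
  let ?I = "{(i, j). i < j \<and> j < length xs \<and> xs ! i > xs ! j}"
  let ?J = "{j. j < length xs \<and> xs ! j < x}"
  have fin: "finite ?I" by (rule finite_subset[of _ "{..<length xs} \<times> {..<length xs}"]) auto
  have "{(i, j). i < j \<and> j < length (x # xs) \<and> (x # xs) ! i > (x # xs) ! j}
      = (\<lambda>j. (0::nat, Suc j)) ` ?J \<union> map_prod Suc Suc ` ?I" (is "?L = ?R")
  proof (rule set_eqI, clarify)
    fix i j show "(i, j) \<in> ?L \<longleftrightarrow> (i, j) \<in> ?R"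
      by (cases i; cases j) auto
  qed
  then have "inv_num (x # xs) = card ((\<lambda>j. (0::nat, Suc j)) ` ?J) + card (map_prod Suc Suc ` ?I)"
    unfolding inv_num_def using fin by (simp only:, subst card_Un_disjoint) auto
  also have "\<dots> = card ?J + card ?I"
    by (auto simp: card_image inj_on_def)
  finally show ?thesis by (simp add: length_filter_conv_card inv_num_def)
qed

text \<open>
  The inversions between an arrangement of \<open>A\<close> and a later arrangement of \<open>B\<close>.
\<close>
definition cross_inv :: "nat set \<Rightarrow> nat set \<Rightarrow> nat" where
  "cross_inv A B = (\<Sum>a\<in>A. card {b\<in>B. b < a})"

lemma inv_num_sorted_append:
  assumes "sorted_wrt (<) as" "distinct bs"
  shows "inv_num (as @ bs) = cross_inv (set as) (set bs) + inv_num bs"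
  using assms(1)
proof (induction as)
  case (Cons a as)
  have "filter (\<lambda>y. y < a) as = []" using Cons.prems by (auto simp: filter_empty_conv)
  moreover have "length (filter (\<lambda>y. y < a) bs) = card {b \<in> set bs. b < a}"
    using assms(2) by (simp flip: distinct_card)
  moreover have "a \<notin> set as" using Cons.prems by auto
  ultimately show ?case using Cons by (simp add: inv_num_Cons cross_inv_def)
qed (simp add: cross_inv_def)

text \<open>
  The smallest entry in front contributes nothing and the increasing block has no inversions of
  its own. The summand \<open>card A\<close> comes from the inversions of the block with \<open>p\<close>; it is the
  origin of the factor $q^k$ in the recurrence.
\<close>
lemma inv_num_glue:
  assumes A: "finite A" "p \<notin> A" "\<forall>a\<in>A. p < a" and m: "\<forall>a\<in>A. m < a" "\<forall>a\<in>set r. m < a"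
    and r: "set r = insert p B" "p \<notin> B" "distinct r"
  shows "inv_num (glue m (A, r)) = card A + cross_inv A B + inv_num r"
proof -
  have finB: "finite B" using r(1) by (metis List.finite_set finite_insert)
  have "filter (\<lambda>y. y < m) (sorted_list_of_set A @ r) = []"
    using A m by (fastforce simp: filter_empty_conv)
  then have "inv_num (glue m (A, r)) = inv_num (sorted_list_of_set A @ r)"
    unfolding glue_def by (simp add: inv_num_Cons)
  also have "\<dots> = cross_inv A (insert p B) + inv_num r"
    using A r by (simp add: inv_num_sorted_append)
  also have "cross_inv A (insert p B) = (\<Sum>a\<in>A. Suc (card {b\<in>B. b < a}))"
    unfolding cross_inv_def
  proof (rule sum.cong)
    fix a assume a: "a \<in> A"
    have "{b \<in> insert p B. b < a} = insert p {b\<in>B. b < a}" using a A by auto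
    then show "card {b \<in> insert p B. b < a} = Suc (card {b\<in>B. b < a})"
      using finB r(2) by simp
  qed simp
  also have "\<dots> = card A + cross_inv A B"
    by (subst sum_Suc) (simp add: cross_inv_def)
  finally show ?thesis by simp
qed

section \<open>Gaussian binomials count subsets by cross inversions\<close>

text \<open>
  Series in $q$ form an integral domain but not a field. The \<open>q\<close>-factorials have constant
  term $1$ and are therefore units, which makes division by them exact.
\<close>

lemma q_int_add: "q_int (a + b) = q_int a + Q ^ a * q_int b"
  by (induction b) (simp_all add: q_int_def algebra_simps power_add)

lemma q_int_Suc: "q_int (Suc n) = 1 + Q * q_int n"
  using q_int_add[of 1 n] by (simp add: q_int_def)

lemma one_minus_Q_q_int: "(1 - Q) * q_int n = 1 - Q ^ n"
  by (simp add: q_int_def one_diff_power_eq)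

lemma q_fact_0 [simp]: "q_fact 0 = 1"
  by (simp add: q_fact_def)

lemma q_fact_Suc: "q_fact (Suc n) = q_fact n * q_int (Suc n)"
  by (simp add: q_fact_def)

lemma q_fact_nth_0: "fps_nth (q_fact n) 0 = 1"
  by (induction n) (simp_all add: q_fact_Suc q_int_Suc)

lemma q_fact_inverse: "q_fact n * inverse (q_fact n) = 1"
  by (simp add: inverse_mult_eq_1' q_fact_nth_0)

lemma q_fact_nonzero [simp]: "q_fact n \<noteq> 0"
  using q_fact_nth_0[of n] by auto

lemma divide_q_fact: "f / q_fact n = f * inverse (q_fact n)"
  by (simp add: fps_divide_unit q_fact_nth_0)

definition subset_sum :: "nat set \<Rightarrow> nat \<Rightarrow> rat fps" where
  "subset_sum S k = (\<Sum>A | A \<subseteq> S \<and> card A = k. Q ^ cross_inv A (S - A))"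

lemma subset_sum_0: "finite S \<Longrightarrow> subset_sum S 0 = 1"
proof -
  assume "finite S"
  then have "{A. A \<subseteq> S \<and> card A = 0} = {{}}" by (auto dest: finite_subset)
  then show ?thesis by (simp add: subset_sum_def cross_inv_def)
qed

lemma subset_sum_eq_0: "finite S \<Longrightarrow> card S < k \<Longrightarrow> subset_sum S k = 0"
  unfolding subset_sum_def by (rule sum.neutral) (auto dest: card_mono)

text \<open>
  The \<open>q\<close>-Pascal rule: if the new maximum \<open>b\<close> is not chosen it creates no cross inversions, and
  if it is chosen it forms one with each of the \<open>card S - k\<close> elements left out.
\<close>
lemma subset_sum_insert_max:
  assumes fin: "finite S" and max: "\<forall>a\<in>S. a < b"
  shows "subset_sum (insert b S) (Suc k) = subset_sum S (Suc k) + Q ^ (card S - k) * subset_sum S k"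
proof -
  have b: "b \<notin> S" using max by auto
  let ?P = "\<lambda>k. {A. A \<subseteq> S \<and> card A = k}"
  have finP: "finite (?P k)" for k using fin by simp
  have finA: "finite A" if "A \<subseteq> S" for A using that fin by (rule finite_subset)
  have split: "{A. A \<subseteq> insert b S \<and> card A = Suc k} = ?P (Suc k) \<union> insert b ` ?P k" (is "?L = ?R")
  proof (intro equalityI subsetI)
    fix A assume A: "A \<in> ?L"
    show "A \<in> ?R"
    proof (cases "b \<in> A")
      case True
      then have "A = insert b (A - {b})" "A - {b} \<subseteq> S" "card (A - {b}) = k"
        using A by auto
      then show ?thesis by blast
    next
      case False
      then show ?thesis using A by auto
    qed
  next
    fix A assume "A \<in> ?R"
    then show "A \<in> ?L" using b finA by (auto simp: card_insert_if)
  qed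
  have inj: "inj_on (insert b) (?P k)"
    using b by (auto simp: inj_on_def)
  have lower: "cross_inv A (insert b S - A) = cross_inv A (S - A)" if "A \<subseteq> S" for A
    unfolding cross_inv_def
  proof (intro sum.cong refl)
    fix a assume "a \<in> A"
    then have "a < b" using that max by auto
    then have "{x \<in> insert b S - A. x < a} = {x \<in> S - A. x < a}" by auto
    then show "card {x \<in> insert b S - A. x < a} = card {x \<in> S - A. x < a}" by simp
  qed
  have upper: "cross_inv (insert b A) (insert b S - insert b A) = cross_inv A (S - A) + (card S - card A)"
    if "A \<subseteq> S" for A
  proof -
    have "insert b S - insert b A = S - A" using b by auto
    moreover have "{x \<in> S - A. x < b} = S - A" using max by auto
    moreover have "b \<notin> A" using b that by auto
    ultimately show ?thesis
      using that finA by (simp add: cross_inv_def card_Diff_subset)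
  qed
  have "subset_sum (insert b S) (Suc k)
      = (\<Sum>A\<in>?P (Suc k). Q ^ cross_inv A (insert b S - A))
        + (\<Sum>A\<in>insert b ` ?P k. Q ^ cross_inv A (insert b S - A))"
    unfolding subset_sum_def split using finP b by (intro sum.union_disjoint) auto
  also have "(\<Sum>A\<in>?P (Suc k). Q ^ cross_inv A (insert b S - A)) = subset_sum S (Suc k)"
    unfolding subset_sum_def by (intro sum.cong) (auto simp: lower)
  also have "(\<Sum>A\<in>insert b ` ?P k. Q ^ cross_inv A (insert b S - A))
      = (\<Sum>A\<in>?P k. Q ^ cross_inv (insert b A) (insert b S - insert b A))"
    using inj by (simp add: sum.reindex)
  also have "\<dots> = Q ^ (card S - k) * subset_sum S k"
    unfolding subset_sum_def sum_distrib_left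
    by (intro sum.cong refl) (simp only: mem_Collect_eq upper power_add mult.commute)
  finally show ?thesis .
qed

text \<open>
  Induction with the \<open>q\<close>-Pascal rule. With $n=|S|$, $l+1$ elements chosen from $n+1$ and the
  factorials cleared, it reduces to $(n+1)_q=(n-l)_q+q^{n-l}(l+1)_q$.
\<close>
lemma subset_sum_q_fact:
  assumes "finite S" "k \<le> card S"
  shows "subset_sum S k * (q_fact k * q_fact (card S - k)) = q_fact (card S)"
  using assms
proof (induction S arbitrary: k rule: finite_linorder_max_induct)
  case empty
  then show ?case by (simp add: subset_sum_0)
next
  case (insert b S)
  then have card: "card (insert b S) = Suc (card S)" by (subst card_insert_disjoint) auto
  define n where "n = card S"
  show ?case
  proof (cases k)
    case 0
    then show ?thesis using insert.hyps by (simp add: subset_sum_0)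
  next
    case (Suc l)
    have l: "l \<le> n" using insert.prems card Suc by (simp add: n_def)
    have rec: "subset_sum (insert b S) (Suc l) = subset_sum S (Suc l) + Q ^ (n - l) * subset_sum S l"
      using insert.hyps by (simp add: subset_sum_insert_max n_def)
    have IH: "subset_sum S l * (q_fact l * q_fact (n - l)) = q_fact n"
      using insert.IH[of l] l by (simp add: n_def)
    have lower: "subset_sum S (Suc l) * (q_fact (Suc l) * q_fact (n - l)) = q_fact n * q_int (n - l)"
    proof (cases "l = n")
      case True
      then show ?thesis using insert.hyps by (simp add: subset_sum_eq_0 n_def q_int_def)
    next
      case False
      then have nl: "n - l = Suc (n - Suc l)" using l by simp
      have "subset_sum S (Suc l) * (q_fact (Suc l) * q_fact (n - Suc l)) = q_fact n"
        using insert.IH[of "Suc l"] l False by (simp add: n_def)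
      then show ?thesis unfolding nl q_fact_Suc[of "n - Suc l"] by (metis mult.assoc)
    qed
    have "Suc n = (n - l) + Suc l" using l by simp
    then have qi: "q_int (Suc n) = q_int (n - l) + Q ^ (n - l) * q_int (Suc l)"
      using q_int_add[of "n - l" "Suc l"] by simp
    have "subset_sum (insert b S) (Suc l) * (q_fact (Suc l) * q_fact (n - l))
        = q_fact n * q_int (n - l)
          + Q ^ (n - l) * (subset_sum S l * (q_fact l * q_fact (n - l))) * q_int (Suc l)"
      unfolding rec distrib_right lower by (simp add: q_fact_Suc mult_ac)
    also have "\<dots> = q_fact (Suc n)" unfolding IH by (simp add: q_fact_Suc qi algebra_simps)
    finally show ?thesis by (simp add: Suc card n_def)
  qed
qed

lemma subset_sum_eq_q_binomial:
  assumes "finite S" "k \<le> card S"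
  shows "subset_sum S k = q_binomial (card S) k"
proof -
  have "q_binomial (card S) k
      = subset_sum S k * (q_fact k * q_fact (card S - k)) / (q_fact k * q_fact (card S - k))"
    by (simp only: q_binomial_def subset_sum_q_fact[OF assms])
  also have "\<dots> = subset_sum S k"
    by (rule nonzero_mult_div_cancel_right) simp
  finally show ?thesis by (rule sym)
qed

section \<open>The recurrence for run-sorted permutations\<close>

lemma sum_Pow_by_card:
  assumes "finite S"
  shows "(\<Sum>A\<in>Pow S. F A) = (\<Sum>k\<le>card S. \<Sum>A | A \<subseteq> S \<and> card A = k. F A)"
proof -
  have "(\<Sum>A\<in>Pow S. F A) = (\<Sum>k\<in>{..card S}. \<Sum>A | A \<in> Pow S \<and> card A = k. F A)"
    using assms by (intro sum.group[symmetric]) (auto intro: card_mono)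
  then show ?thesis by simp
qed

text \<open>
  The \<open>q\<close>-composition ignores the constant term, where $q^{k-1}$ has no meaning and the truncated
  exponent below yields an arbitrary value.
\<close>
lemma e_q_comp_coeff_cong:
  assumes "\<And>k. f (Suc k) = g (Suc k)"
  shows "e_q_comp_coeff f n = e_q_comp_coeff g n"
proof (induction n rule: less_induct)
  case (less n)
  then show ?case by (cases n) (simp_all add: assms)
qed

text \<open>
  The decomposition at the second smallest entry, sorted by the size of the block, is exactly the
  recurrence of the \<open>q\<close>-composition. The induction is over sets of every shape because the tail
  lives on a set with gaps.
\<close>
lemma sum_run_sorted_on:
  assumes "finite S" "S \<noteq> {}"
  shows "(\<Sum>\<pi>\<in>run_sorted_on S. Q ^ inv_num \<pi>) = e_q_comp_coeff (\<lambda>k. Q ^ (k - 1)) (card S - 1)"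
  using assms
proof (induction "card S" arbitrary: S rule: less_induct)
  case less
  let ?g = "e_q_comp_coeff (\<lambda>k. Q ^ (k - 1))"
  define m where "m = Min S"
  define U where "U = S - {m}"
  have mS: "m \<in> S" using less.prems by (simp add: m_def)
  have card_U: "card U = card S - 1" and finU: "finite U"
    using mS less.prems by (simp_all add: U_def)
  show ?case
  proof (cases "U = {}")
    case True
    then have "S = {m}" using mS by (auto simp: U_def)
    moreover have "run_sorted_on {m} = {[m]}"
      by (auto simp: run_sorted_on_def)
    ultimately show ?thesis by (simp add: inv_num_Cons inv_num_def[of "[]"])
  next
    case False
    define p where "p = Min U"
    define T where "T = U - {p}"
    have pU: "p \<in> U" using False finU by (simp add: p_def)
    have finT: "finite T" using finU by (simp add: T_def)
    have card_T: "card U = Suc (card T)"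
      unfolding T_def using pU finU by (rule card.remove[rotated])
    have m_less: "m < y" if "y \<in> U" for y
      using that Min_le[OF less.prems(1), of y] by (simp add: U_def m_def)
    have p_less: "p < y" if "y \<in> T" for y
      using that Min_le[OF finU, of y] by (simp add: T_def p_def)
    have inv: "inv_num (glue m (A, r)) = card A + cross_inv A (T - A) + inv_num r"
      if A: "A \<subseteq> T" and r: "r \<in> run_sorted_on (U - A)" for A r
    proof (rule inv_num_glue)
      have "set r = U - A" "distinct r" using r by (auto simp: run_sorted_on_def permutations_of_set_def)
      then show "\<forall>a\<in>set r. m < a" "set r = insert p (T - A)" "distinct r"
        using m_less pU A by (auto simp: T_def)
      show "finite A" using A finT by (rule finite_subset)
    qed (use A p_less m_less in \<open>auto simp: T_def\<close>)
    have "(\<Sum>\<pi>\<in>run_sorted_on S. Q ^ inv_num \<pi>)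
        = (\<Sum>(A, r)\<in>(SIGMA A:Pow T. run_sorted_on (U - A)). Q ^ inv_num (glue m (A, r)))"
      using sum.reindex_bij_betw[OF run_sorted_on_decomposition[OF less.prems(1) m_def U_def p_def False],
          of "\<lambda>\<pi>. Q ^ inv_num \<pi>"]
      by (simp add: T_def split_beta)
    also have "\<dots> = (\<Sum>A\<in>Pow T. \<Sum>r\<in>run_sorted_on (U - A). Q ^ inv_num (glue m (A, r)))"
      using finT by (subst sum.Sigma) (auto simp: run_sorted_on_def)
    also have "\<dots> = (\<Sum>A\<in>Pow T. Q ^ card A * Q ^ cross_inv A (T - A) * ?g (card T - card A))"
    proof (rule sum.cong)
      fix A assume "A \<in> Pow T"
      then have A: "A \<subseteq> T" by simp
      then have finA: "finite A" using finT by (rule finite_subset)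
      have "card A \<le> card T" using A finT by (rule card_mono[rotated])
      have "A \<subseteq> U" using A by (auto simp: T_def)
      then have card: "card (U - A) = Suc (card T - card A)"
        using finA card_T \<open>card A \<le> card T\<close> by (simp add: card_Diff_subset)
      have "(\<Sum>r\<in>run_sorted_on (U - A). Q ^ inv_num r) = ?g (card (U - A) - 1)"
      proof (rule less.hyps)
        show "card (U - A) < card S" using card card_U card_T by simp
        show "finite (U - A)" using finU by simp
        show "U - A \<noteq> {}" using A pU by (auto simp: T_def)
      qed
      then have "(\<Sum>r\<in>run_sorted_on (U - A). Q ^ inv_num r) = ?g (card T - card A)"
        by (simp add: card)
      then show "(\<Sum>r\<in>run_sorted_on (U - A). Q ^ inv_num (glue m (A, r)))
          = Q ^ card A * Q ^ cross_inv A (T - A) * ?g (card T - card A)"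
        by (simp add: inv[OF A] power_add flip: sum_distrib_left)
    qed simp
    also have "\<dots> = (\<Sum>k\<le>card T. \<Sum>A | A \<subseteq> T \<and> card A = k.
        Q ^ card A * Q ^ cross_inv A (T - A) * ?g (card T - card A))"
      using finT by (rule sum_Pow_by_card)
    also have "\<dots> = (\<Sum>k\<le>card T. subset_sum T k * (Q ^ k * ?g (card T - k)))"
      unfolding subset_sum_def sum_distrib_right by (intro sum.cong refl) (auto simp: mult_ac)
    also have "\<dots> = ?g (Suc (card T))"
      using finT by (simp add: subset_sum_eq_q_binomial mult_ac)
    also have "Suc (card T) = card S - 1" using card_U card_T by simp
    finally show ?thesis .
  qed
qed

lemma A_gf_eq_e_q_comp_coeff:
  "A_gf (n + 1) Q 1 = e_q_comp_coeff (\<lambda>k. Q ^ (k - 1)) n"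
  using sum_run_sorted_on[of "{1..Suc n}"]
  by (simp add: A_gf_def run_sorted_perms_eq_run_sorted_on)

section \<open>The generating function and its product expansion\<close>

lemma scale_arg_nth: "fps_nth (scale_arg f c) n = c ^ n * fps_nth f n"
  by (simp add: scale_arg_def fps_compose_linear)

lemma e_q_nth: "fps_nth e_q n = inverse (q_fact n)"
  by (simp add: e_q_def q_egf_def divide_q_fact)

text \<open>
  Division by the non-unit $q$ is exact here, because the coefficient of $e_q(qx)$ at a positive
  power of $x$ contains a factor $q$.
\<close>
lemma q_egf_coeff_shifted_e_q:
  "q_egf_coeff (divide_coeffs (scale_arg e_q Q - 1) Q) (Suc k) = Q ^ k"
proof -
  have "fps_nth (divide_coeffs (scale_arg e_q Q - 1) Q) (Suc k)
      = (Q ^ k * inverse (q_fact (Suc k))) * Q / Q"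
    unfolding divide_coeffs_def by (simp add: scale_arg_nth e_q_nth mult_ac)
  also have "\<dots> = Q ^ k * inverse (q_fact (Suc k))"
    by (rule nonzero_mult_div_cancel_right) simp
  finally show ?thesis
    using q_fact_inverse[of "Suc k"]
    by (simp add: q_egf_coeff_def mult.assoc mult.commute[of "inverse _"])
qed

lemma run_sorted_egf:
  "q_egf (\<lambda>n. A_gf (n + 1) Q 1) = e_q_comp (divide_coeffs (scale_arg e_q Q - 1) Q)"
  unfolding e_q_comp_def A_gf_eq_e_q_comp_coeff
  by (intro arg_cong[of _ _ q_egf] ext e_q_comp_coeff_cong) (simp add: q_egf_coeff_shifted_e_q)

lemma q_binomial_eq:
  "q_binomial n k = q_fact n * inverse (q_fact k) * inverse (q_fact (n - k))"
proof -
  have "q_fact n = q_fact n * (q_fact k * inverse (q_fact k)) * (q_fact (n - k) * inverse (q_fact (n - k)))"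
    by (simp add: q_fact_inverse)
  also have "\<dots> = q_fact n * inverse (q_fact k) * inverse (q_fact (n - k)) * (q_fact k * q_fact (n - k))"
    by (simp only: mult_ac)
  finally have "q_fact n / (q_fact k * q_fact (n - k)) =
      (q_fact n * inverse (q_fact k) * inverse (q_fact (n - k)) * (q_fact k * q_fact (n - k)))
        / (q_fact k * q_fact (n - k))"
    by (rule arg_cong)
  then show ?thesis by (simp add: q_binomial_def)
qed

text \<open>
  Divided by $n_q^!$, the recurrence of the \<open>q\<close>-composition $G=e_q[f]$ is the chain rule
  $D_qG=(D_qf)\,G$ for the \<open>q\<close>-derivative $D_q$, which sends $x^{n+1}$ to $(n+1)_q\,x^n$.
\<close>
lemma e_q_comp_coeff_q_derivative:
  fixes f :: "nat \<Rightarrow> rat fps"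
  defines "G \<equiv> \<lambda>n. e_q_comp_coeff f n * inverse (q_fact n)"
  shows "q_int (Suc n) * G (Suc n) = (\<Sum>k\<le>n. f (Suc k) * inverse (q_fact k) * G (n - k))"
proof -
  have inv: "q_int (Suc n) * inverse (q_fact (Suc n)) * q_fact n = 1"
    using q_fact_inverse[of "Suc n"] by (simp add: q_fact_Suc mult_ac)
  have "q_int (Suc n) * G (Suc n)
      = (\<Sum>k\<le>n. (q_int (Suc n) * inverse (q_fact (Suc n)) * q_fact n) *
          (f (Suc k) * inverse (q_fact k) * G (n - k)))"
    unfolding G_def e_q_comp_coeff.simps sum_distrib_right sum_distrib_left
    by (intro sum.cong refl) (simp add: q_binomial_eq mult_ac)
  then show ?thesis unfolding inv by simp
qed

text \<open>
  The functional equation $G(x)\,(1-(1-q)x\,e_q(qx))=G(qx)$ at $q^jx$. It follows from the chain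
  rule by $(1-q)\,n_q=1-q^n$, the factor that distinguishes the coefficients of $G(x)$ and
  $G(x)-G(qx)$.
\<close>
lemma e_q_comp_scale_step:
  fixes G :: "rat fps fps"
  defines "G \<equiv> q_egf (e_q_comp_coeff (\<lambda>k. Q ^ (k - 1)))"
  shows "scale_arg G (Q ^ j) * (1 - fps_const ((1 - Q) * Q ^ j) * X * scale_arg e_q (Q ^ (j + 1)))
       = scale_arg G (Q ^ Suc j)"
proof -
  let ?H = "scale_arg G (Q ^ j)"
  let ?E = "scale_arg e_q (Q ^ (j + 1))"
  have G_nth: "fps_nth G n = e_q_comp_coeff (\<lambda>k. Q ^ (k - 1)) n * inverse (q_fact n)" for n
    by (simp add: G_def q_egf_def divide_q_fact)
  have rec: "q_int (Suc n) * fps_nth G (Suc n)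
      = (\<Sum>k\<le>n. Q ^ k * inverse (q_fact k) * fps_nth G (n - k))" for n
    unfolding G_nth using e_q_comp_coeff_q_derivative[of n "\<lambda>k. Q ^ (k - 1)"] by simp
  have "?H - scale_arg G (Q ^ Suc j) = X * (fps_const ((1 - Q) * Q ^ j) * (?E * ?H))"
  proof (rule fps_ext)
    fix n
    show "fps_nth (?H - scale_arg G (Q ^ Suc j)) n
        = fps_nth (X * (fps_const ((1 - Q) * Q ^ j) * (?E * ?H))) n"
    proof (cases n)
      case 0
      then show ?thesis by (simp add: scale_arg_nth)
    next
      case (Suc n')
      have "(Q ^ (j + 1)) ^ k * (Q ^ j) ^ (n' - k) = (Q ^ j) ^ n' * Q ^ k" if "k \<le> n'" for k
      proof -
        have "(Q ^ (j + 1)) ^ k * (Q ^ j) ^ (n' - k) = Q ^ ((j + 1) * k + j * (n' - k))"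
          by (simp only: power_mult power_add)
        also have "(j + 1) * k + j * (n' - k) = j * n' + k"
          using le_Suc_ex[OF that] by (auto simp: algebra_simps)
        finally show ?thesis by (simp only: power_mult power_add)
      qed
      then have "fps_nth (?E * ?H) n'
          = (Q ^ j) ^ n' * (\<Sum>k\<le>n'. Q ^ k * inverse (q_fact k) * fps_nth G (n' - k))"
        unfolding fps_mult_nth sum_distrib_left atMost_atLeast0
        by (intro sum.cong refl) (simp add: scale_arg_nth e_q_nth mult_ac)
      then have "fps_nth (X * (fps_const ((1 - Q) * Q ^ j) * (?E * ?H))) n
          = (1 - Q) * Q ^ j * ((Q ^ j) ^ n' * (q_int n * fps_nth G n))"
        by (simp add: Suc rec)
      also have "\<dots> = ((1 - Q) * q_int n) * ((Q ^ j) ^ n * fps_nth G n)"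
        by (simp only: Suc power_Suc mult_ac)
      also have "\<dots> = fps_nth (?H - scale_arg G (Q ^ Suc j)) n"
        unfolding one_minus_Q_q_int by (simp add: scale_arg_nth power_mult_distrib algebra_simps)
      finally show ?thesis by simp
    qed
  qed
  then show ?thesis by (simp add: algebra_simps)
qed

text \<open>
  The coefficients \<open>rat fps\<close> do not form a division ring, so invertibility is derived from the
  constant term $1$, which is its own inverse.
\<close>
lemma mult_inverse_unit_fps:
  fixes f :: "rat fps fps"
  assumes "fps_nth f 0 = 1"
  shows "f * inverse f = 1"
  using fps_right_inverse[of f 1] assms by (simp add: fps_inverse_def[where f = f])

text \<open>
  In $G(x)=P_N(x)\,G(q^Nx)$ all terms of the second factor except the constant term $1$ are
  divisible by $q^N$. So the coefficients of $P_N$ and $G$ agree below $q^N$, and coefficientwise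
  stabilisation is convergence in \<open>rat fps\<close>.
\<close>
lemma has_formal_prod_e_q_comp:
  fixes G :: "rat fps fps"
  defines "G \<equiv> q_egf (e_q_comp_coeff (\<lambda>k. Q ^ (k - 1)))"
  shows "has_formal_prod
    (\<lambda>j. inverse (1 - fps_const ((1 - Q) * Q ^ j) * X * scale_arg e_q (Q ^ (j + 1)))) G"
proof -
  define t where "t j = 1 - fps_const ((1 - Q) * Q ^ j) * X * scale_arg e_q (Q ^ (j + 1))" for j
  define P where "P N = (\<Prod>j<N. inverse (t j))" for N
  have t: "t j * inverse (t j) = 1" for j
    by (rule mult_inverse_unit_fps) (simp add: t_def mult.assoc)
  have step: "scale_arg G (Q ^ j) = inverse (t j) * scale_arg G (Q ^ Suc j)" for j
  proof -
    have eq: "scale_arg G (Q ^ j) * t j = scale_arg G (Q ^ Suc j)"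
      unfolding G_def t_def by (rule e_q_comp_scale_step)
    have "inverse (t j) * scale_arg G (Q ^ Suc j) = scale_arg G (Q ^ j) * (t j * inverse (t j))"
      by (simp only: mult_ac flip: eq)
    then show ?thesis by (simp add: t)
  qed
  have telescope: "G = P N * scale_arg G (Q ^ N)" for N
  proof (induction N)
    case 0
    have "scale_arg G 1 = G" by (rule fps_ext) (simp add: scale_arg_nth)
    then show ?case by (simp add: P_def)
  next
    case (Suc N)
    have "G = P N * (inverse (t N) * scale_arg G (Q ^ Suc N))"
      using Suc step[of N] by simp
    then show ?case by (simp add: P_def mult.assoc)
  qed
  have "fps_nth G 0 = 1"
    by (simp add: G_def q_egf_def divide_q_fact)
  have error: "\<exists>r. fps_nth (P N) n = fps_nth G n + Q ^ N * r" for N n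
  proof -
    have "fps_nth G n = (\<Sum>i=0..n. fps_nth (scale_arg G (Q ^ N)) i * fps_nth (P N) (n - i))"
      using telescope[of N] by (metis fps_mult_nth mult.commute)
    also have "\<dots> = fps_nth (P N) n + (\<Sum>i=1..n. (Q ^ N) ^ i * fps_nth G i * fps_nth (P N) (n - i))"
      using \<open>fps_nth G 0 = 1\<close> by (simp add: sum.atLeast_Suc_atMost scale_arg_nth)
    also have "(\<Sum>i=1..n. (Q ^ N) ^ i * fps_nth G i * fps_nth (P N) (n - i))
        = Q ^ N * (\<Sum>i=1..n. (Q ^ N) ^ (i - 1) * fps_nth G i * fps_nth (P N) (n - i))"
      unfolding sum_distrib_left
    proof (intro sum.cong refl)
      fix i assume "i \<in> {1..n}"
      then have "(Q ^ N) ^ i = Q ^ N * (Q ^ N) ^ (i - 1)" by (cases i) auto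
      then show "(Q ^ N) ^ i * fps_nth G i * fps_nth (P N) (n - i)
          = Q ^ N * ((Q ^ N) ^ (i - 1) * fps_nth G i * fps_nth (P N) (n - i))"
        by (simp only: mult.assoc)
    qed
    finally have "fps_nth (P N) n = fps_nth G n
        + Q ^ N * (- (\<Sum>i=1..n. (Q ^ N) ^ (i - 1) * fps_nth G i * fps_nth (P N) (n - i)))"
      by (simp add: algebra_simps)
    then show ?thesis by blast
  qed
  have "(\<lambda>N. fps_nth (P N) n) \<longlonglongrightarrow> fps_nth G n" for n
  proof (rule tendsto_fpsI)
    fix d
    have "fps_nth (fps_nth (P N) n) d = fps_nth (fps_nth G n) d" if "d < N" for N
      using error[of N n] that by (auto simp: fps_X_power_mult_nth)
    then show "eventually (\<lambda>N. fps_nth (fps_nth (P N) n) d = fps_nth (fps_nth G n) d) sequentially"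
      by (rule eventually_mono[OF eventually_gt_at_top[of d]])
  qed
  then show ?thesis by (simp add: has_formal_prod_def P_def t_def)
qed

text \<open>
  The product lemma is stated for the sequence $q^{k-1}$; the first equality carries it over to
  the composition in the theorem.
\<close>
theorem theorem2p6:
  shows "q_egf (\<lambda>n. A_gf (n + 1) Q 1) = e_q_comp (divide_coeffs (scale_arg e_q Q - 1) Q) \<and>
         has_formal_prod
           (\<lambda>j. inverse (1 - fps_const ((1 - Q) * Q ^ j) * X * scale_arg e_q (Q ^ (j + 1))))
           (e_q_comp (divide_coeffs (scale_arg e_q Q - 1) Q))"
proof
  show egf: "q_egf (\<lambda>n. A_gf (n + 1) Q 1) = e_q_comp (divide_coeffs (scale_arg e_q Q - 1) Q)"
    by (rule run_sorted_egf)
  show "has_formal_prod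
           (\<lambda>j. inverse (1 - fps_const ((1 - Q) * Q ^ j) * X * scale_arg e_q (Q ^ (j + 1))))
           (e_q_comp (divide_coeffs (scale_arg e_q Q - 1) Q))"
    using has_formal_prod_e_q_comp unfolding egf[symmetric] A_gf_eq_e_q_comp_coeff .
qed

end
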